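(* Let $i\in\mathbb{N}_0$ and let $\alpha,\beta\in\mathbb{C}$. Then $$F^{1:1;3}_{1:0;2}\left[\begin{matrix}\alpha: & \tfrac12\beta-\tfrac32\alpha-1+i\,; & \tfrac12\beta+\tfrac32\alpha+1-i,\ 1+\tfrac12\alpha,\ \tfrac{\alpha-\beta}{2}\,;\\ \beta: & -\,; & \tfrac12\alpha,\ 1+\tfrac{\alpha+\beta}{2}\,;\end{matrix}\ \tfrac12,\ \tfrac12\right] =\frac{2^{i-\alpha-2}\,\Gamma(\alpha-i+1)\,\Gamma\!\left(1+\frac{\alpha+\beta}{2}\right)}{\Gamma(\alpha+1)\,\Gamma\!\left(\frac{\beta-\alpha}{2}\right)}\sum_{r=0}^{i}(-1)^r\binom{i}{r}\frac{\Gamma\!\left(\frac{\beta-\alpha}{4}+\frac r2\right)}{\Gamma\!\left(\frac{\beta+3\alpha}{4}+1-i+\frac r2\right)}$$ and $$F^{1:1;3}_{1:0;2}\left[\begin{matrix}\alpha: & \tfrac12\beta-\tfrac32\alpha-1-i\,; & \tfrac12\beta+\tfrac32\alpha+1+i,\ 1+\tfrac12\alpha,\ \tfrac{\alpha-\beta}{2}\,;\\ \beta: & -\,; & \tfrac12\alpha,\ 1+\tfrac{\alpha+\beta}{2}\,;\end{matrix}\ \tfrac12,\ \tfrac12\right] =\frac{2^{-i-\alpha-2}\,\Gamma\!\left(1+\frac{\alpha+\beta}{2}\right)}{\Gamma\!\left(\frac{\beta-\alpha}{2}\right)}\sum_{r=0}^{i}\binom{i}{r}\frac{\Gamma\!\left(\frac{\beta-\alpha}{4}+\frac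 r2\right)}{\Gamma\!\left(\frac{\beta+3\alpha}{4}+1+\frac r2\right)}.$$
   Context: For $\lambda\in\mathbb{C}$ and $n\in\mathbb{N}_0$, $(\lambda)_0=1$ and $(\lambda)_n=\lambda(\lambda+1)\cdots(\lambda+n-1)$; $\Gamma$ is Euler's Gamma function and $\binom{i}{r}$ the binomial coefficient. The (generalized) Kampé de Fériet function is defined by $$F^{H:A;B}_{G:C;D}\left[\begin{matrix}(h_H): & (a_A)\,; & (b_B)\,;\\ (g_G): & (c_C)\,; & (d_D)\,;\end{matrix}\ x,\ y\right]=\sum_{m=0}^\infty\sum_{n=0}^\infty\frac{\prod_{j=1}^H(h_j)_{m+n}\prod_{j=1}^A(a_j)_m\prod_{j=1}^B(b_j)_n}{\prod_{j=1}^G(g_j)_{m+n}\prod_{j=1}^C(c_j)_m\prod_{j=1}^D(d_j)_n}\frac{x^m}{m!}\frac{y^n}{n!},$$ where a dash "$-$" denotes an empty list of parameters (empty products equal $1$). Parameters are tacitly assumed to be such that the double series converges, no denominator parameter is a non-positive integer, and all Gamma values appearing are finite. *)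

theory Defs
  imports "HOL-Analysis.Analysis"
begin

text \<open>General term of the Kampe de Feriet double series
  F^{H:A;B}_{G:C;D}[(h):(a);(b);(g):(c);(d); x, y], parameter lists given as lists.\<close>
definition kdf_term ::
  "complex list \<Rightarrow> complex list \<Rightarrow> complex list \<Rightarrow>
   complex list \<Rightarrow> complex list \<Rightarrow> complex list \<Rightarrow>
   complex \<Rightarrow> complex \<Rightarrow> nat \<times> nat \<Rightarrow> complex" where
  "kdf_term h a b g c d x y mn =
     (case mn of (m, n) \<Rightarrow>
       (prod_list (map (\<lambda>p. pochhammer p (m + n)) h)
        * prod_list (map (\<lambda>p. pochhammer p m) a)
        * prod_list (map (\<lambda>p. pochhammer p n) b))
       / (prod_list (map (\<lambda>p. pochhammer p (m + n)) g)
        * prod_list (map (\<lambda>p. pochhammer p m) c)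
        * prod_list (map (\<lambda>p. pochhammer p n) d))
       * (x ^ m / fact m) * (y ^ n / fact n))"

definition kdf ::
  "complex list \<Rightarrow> complex list \<Rightarrow> complex list \<Rightarrow>
   complex list \<Rightarrow> complex list \<Rightarrow> complex list \<Rightarrow>
   complex \<Rightarrow> complex \<Rightarrow> complex" where
  "kdf h a b g c d x y = infsum (kdf_term h a b g c d x y) UNIV"

end

theory Submission
  imports Defs
begin

text \<open>
  Both double series have the shape \<open>\<delta> + \<gamma> = \<beta>\<close>. Summing along the diagonals \<open>m + n = N\<close> and applying
  the Pfaff--Saalschuetz identity twice shows that, as a power series in \<open>z = x = y\<close>, the
  double series equals \<open>(1 - z) \<^sub>2F\<^sub>1(1 + \<alpha>, d - \<gamma>; d; z)\<close> with \<open>d = 1 + (\<alpha> + \<beta>)/2\<close>. Here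
  \<open>d - \<gamma> = \<plusminus>i - \<alpha>\<close>, so at \<open>z = 1/2\<close> one needs \<open>\<^sub>2F\<^sub>1(a, b; c; 1/2)\<close> with \<open>a + b = 1 \<plusminus> i\<close>, which is
  contiguous to Bailey's theorem (\<open>a + b = 1\<close>). Bailey's theorem follows by iterating the
  contiguity relation \<open>c \<rightarrow> c + 2\<close> and letting \<open>c\<close> tend to infinity; the case of general \<open>i\<close>
  satisfies a Pascal-type recurrence in \<open>i\<close>, which yields the binomial sums.
\<close>

section \<open>Pochhammer symbols and Gamma quotients away from the non-positive integers\<close>

lemma pochhammer_ne_0: "pochhammer z n \<noteq> 0" if "z \<notin> \<int>\<^sub>\<le>\<^sub>0" for z :: complex
  using that pochhammer_eq_0_imp_nonpos_Int by blast

lemma not_nonpos_Int_plus_of_nat: "z + of_nat n \<notin> \<int>\<^sub>\<le>\<^sub>0"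
  if "z \<notin> \<int>\<^sub>\<le>\<^sub>0" for z :: complex
  using that nonpos_Ints_diff_Nats[of "z + of_nat n" "of_nat n"] by auto

lemma one_plus_of_nat_ne_0: "1 + of_nat n \<noteq> (0 :: complex)"
  by (metis of_nat_Suc of_nat_neq_0)

text \<open>Converts terms of the regularised series below into ordinary hypergeometric
  terms.\<close>

lemma Gamma_times_rGamma_plus_of_nat:
  fixes c :: complex
  assumes c: "c \<notin> \<int>\<^sub>\<le>\<^sub>0"
  shows "Gamma c * rGamma (c + of_nat n) = 1 / pochhammer c n"
  using pochhammer_rGamma[of c n] pochhammer_ne_0[OF c, of n] c not_nonpos_Int_plus_of_nat[OF c, of n]
  by (simp add: Gamma_def field_simps rGamma_eq_zero_iff)

section \<open>The Pfaff-Saalschuetz identity\<close>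

text \<open>This is the coefficient of z^N in Euler's transformation (1 - z)^(p+q-r) 2F1(p, q; r; z)
  = 2F1(r-p, r-q; r; z). Creative telescoping gives the sum the same first-order recurrence in
  \<open>N\<close> as the closed form.\<close>

lemma pfaff_saalschuetz:
  fixes p q r :: complex
  assumes r: "r \<notin> \<int>\<^sub>\<le>\<^sub>0"
  shows "(\<Sum>n\<le>N. pochhammer (r - p - q) (N - n) / fact (N - n)
            * (pochhammer p n * pochhammer q n / (pochhammer r n * fact n)))
         = pochhammer (r - p) N * pochhammer (r - q) N / (pochhammer r N * fact N)"
proof (induction N)
  case 0
  show ?case by simp
next
  case (Suc N)
  define t where "t = r - p - q"
  define w where "w n = pochhammer p n * pochhammer q n / (pochhammer r n * fact n)" for n
  define F where "F N n = pochhammer t (N - n) / fact (N - n) * w n" for N n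
  \<comment> \<open>The WZ companion of \<open>F N\<close>; the second branch is the value of the rational expression at
    \<open>n = Suc N\<close>, where truncated subtraction would spoil the first one.\<close>
  define G where "G n = (if n \<le> N then - (pochhammer t (N - n) / fact (Suc N - n)) * w n
      * of_nat n * (r + of_nat n - 1) * (t + of_nat (N - n)) else - w (Suc N) * (of_nat (Suc N)) * (r + of_nat N))"
    for n
  have rn: "r + of_nat n \<noteq> 0" for n
    using r plus_of_nat_eq_0_imp by blast
  have pr: "pochhammer r n \<noteq> 0" for n
    using r by (rule pochhammer_ne_0)
  have w_Suc: "w (Suc n) * (of_nat n + 1) * (r + of_nat n) = w n * (p + of_nat n) * (q + of_nat n)" for n
  proof -
    have n1: "1 + of_nat n \<noteq> (0::complex)"
      by (rule one_plus_of_nat_ne_0)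
    show ?thesis
      unfolding w_def pochhammer_Suc fact_Suc using rn[of n] pr[of n] n1
      by (simp add: divide_simps)
  qed
  have step: "(r + of_nat N) * (of_nat N + 1) * F (Suc N) n
          - (r - p + of_nat N) * (r - q + of_nat N) * F N n = G (Suc n) - G n" if n: "n \<le> N" for n
  proof -
    obtain k where k: "N = n + k" using n le_Suc_ex by blast
    \<comment> \<open>A common factor: both \<open>F\<close> values and both \<open>G\<close> values
      below are polynomial multiples of \<open>u\<close>.\<close>
    define u where "u = pochhammer t k / fact (Suc k) * w n"
    have k1: "1 + of_nat k \<noteq> (0::complex)"
      by (rule one_plus_of_nat_ne_0)
    have F1: "F (Suc N) n = u * (t + of_nat k)"
      by (simp add: F_def u_def k pochhammer_Suc Suc_diff_le)
    have F0: "F N n = u * (of_nat k + 1)"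
      using k1 by (simp add: F_def u_def k add.commute)
    have G0: "G n = - u * of_nat n * (r + of_nat n - 1) * (t + of_nat k)"
      by (simp add: G_def u_def k Suc_diff_le)
    have G1: "G (Suc n) = - u * (of_nat k + 1) * (p + of_nat n) * (q + of_nat n)"
    \<comment> \<open>For \<open>k = 0\<close>, that is \<open>n = N\<close>, the value
      \<open>G (Suc n)\<close> comes from the second branch of \<open>G\<close>.\<close>
    proof (cases k)
      case 0
      have "G (Suc n) = - (w (Suc n) * (of_nat n + 1) * (r + of_nat n))"
        by (simp add: G_def k 0 algebra_simps)
      also have "\<dots> = - u * (of_nat k + 1) * (p + of_nat n) * (q + of_nat n)"
        unfolding w_Suc by (simp add: u_def 0)
      finally show ?thesis .
    next
      case (Suc j)
      have "G (Suc n) = - (pochhammer t j * (t + of_nat j) / fact (Suc j)) * (w (Suc n) * (of_nat n + 1) * (r + of_nat n))"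
        by (simp add: G_def k Suc mult_ac add_ac)
      also have "\<dots> = - F N n * (p + of_nat n) * (q + of_nat n)"
        unfolding w_Suc by (simp add: F_def k Suc pochhammer_Suc mult_ac)
      also have "\<dots> = - u * (of_nat k + 1) * (p + of_nat n) * (q + of_nat n)"
        unfolding F0 by simp
      finally show ?thesis .
    qed
    show ?thesis
      unfolding F0 F1 G0 G1 by (simp add: t_def k algebra_simps)
  qed
  \<comment> \<open>The sum for \<open>Suc N\<close> has one term beyond the telescoped range; it
    cancels the boundary value \<open>G (Suc N)\<close>.\<close>
  have top: "(r + of_nat N) * (of_nat N + 1) * F (Suc N) (Suc N) = - G (Suc N)"
    by (simp add: F_def G_def algebra_simps)
  have "(\<Sum>n\<le>N. (r + of_nat N) * (of_nat N + 1) * F (Suc N) n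
          - (r - p + of_nat N) * (r - q + of_nat N) * F N n) = (\<Sum>n\<le>N. G (Suc n) - G n)"
    by (intro sum.cong) (use step in auto)
  also have "\<dots> = G (Suc N) - G 0"
    by (induction N) (simp_all add: lessThan_Suc_atMost)
  also have "G 0 = 0" by (simp add: G_def)
  finally have "(r + of_nat N) * (of_nat N + 1) * (\<Sum>n\<le>N. F (Suc N) n)
      - (r - p + of_nat N) * (r - q + of_nat N) * (\<Sum>n\<le>N. F N n) = G (Suc N)"
    by (simp only: sum_subtractf sum_distrib_left diff_zero)
  hence "(r + of_nat N) * (of_nat N + 1) * (\<Sum>n\<le>Suc N. F (Suc N) n)
      = (r - p + of_nat N) * (r - q + of_nat N) * (\<Sum>n\<le>N. F N n)"
    using top by (simp only: sum.atMost_Suc distrib_left) (simp add: diff_eq_eq)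
  also have "(\<Sum>n\<le>N. F N n) = pochhammer (r - p) N * pochhammer (r - q) N / (pochhammer r N * fact N)"
    using Suc.IH by (simp add: F_def w_def t_def)
  finally have *: "(r + of_nat N) * (of_nat N + 1) * (\<Sum>n\<le>Suc N. F (Suc N) n) =
    (r - p + of_nat N) * (r - q + of_nat N) *
      (pochhammer (r - p) N * pochhammer (r - q) N / (pochhammer r N * fact N))" .
  have N1: "1 + of_nat N \<noteq> (0::complex)" "of_nat N + 1 \<noteq> (0::complex)"
    using one_plus_of_nat_ne_0[of N] by (simp_all add: add.commute)
  have "(\<Sum>n\<le>Suc N. F (Suc N) n) =
    (r - p + of_nat N) * (r - q + of_nat N) *
      (pochhammer (r - p) N * pochhammer (r - q) N / (pochhammer r N * fact N))
      / ((r + of_nat N) * (of_nat N + 1))"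
    unfolding *[symmetric] using rn[of N] N1 by simp
  also have "\<dots> = pochhammer (r - p) (Suc N) * pochhammer (r - q) (Suc N) / (pochhammer r (Suc N) * fact (Suc N))"
    by (simp add: pochhammer_Suc mult_ac add_ac)
  finally show ?case by (simp add: F_def w_def t_def)
qed

section \<open>The regularised Gauss series at 1/2 and its convergence\<close>

text \<open>The regularised function \<open>\<^sub>2F\<^sub>1(a, b; c; 1/2) / \<Gamma>(c)\<close>. The regularisation matters: the contiguity
  relations below lower \<open>c\<close> and may pass through non-positive integers.\<close>
definition regF_term :: "complex \<Rightarrow> complex \<Rightarrow> complex \<Rightarrow> nat \<Rightarrow> complex" where
  "regF_term a b c n = pochhammer a n * pochhammer b n * rGamma (c + of_nat n) / fact n / 2 ^ n"

definition regF :: "complex \<Rightarrow> complex \<Rightarrow> complex \<Rightarrow> complex" where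
  "regF a b c = (\<Sum>n. regF_term a b c n)"

lemma rGamma_shift: "rGamma (c + of_nat n) = (c + of_nat n) * rGamma (c + of_nat (Suc n))" for c :: complex
  using rGamma_plus1[of "c + of_nat n"] by (simp add: add_ac)

text \<open>Ratio test: consecutive terms have a quotient tending to the argument 1/2, hence
  eventually of norm below 3/4.\<close>

lemma summable_norm_regF_term: "summable (\<lambda>n. norm (regF_term a b c n))"
proof -
  have lim1: "(\<lambda>n. (z + of_nat n) / of_nat n) \<longlonglongrightarrow> 1" for z :: complex
  proof -
    have "(\<lambda>n. z / of_nat n + 1) \<longlonglongrightarrow> 0 + 1"
      by (intro tendsto_intros lim_const_over_n)
    moreover have "eventually (\<lambda>n. z / of_nat n + 1 = (z + of_nat n) / of_nat n) sequentially"
      using eventually_gt_at_top[of 0] by eventually_elim (auto simp: field_simps)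
    ultimately show ?thesis by (simp add: filterlim_cong)
  qed
  have "(\<lambda>n. ((a + of_nat n) / of_nat n * ((b + of_nat n) / of_nat n)) /
      ((c + of_nat n) / of_nat n * ((1 + of_nat n) / of_nat n)) / 2) \<longlonglongrightarrow> (1 * 1) / (1 * 1) / 2"
    by (intro tendsto_intros lim1) auto
  hence "(\<lambda>n. norm (((a + of_nat n) / of_nat n * ((b + of_nat n) / of_nat n)) /
      ((c + of_nat n) / of_nat n * ((1 + of_nat n) / of_nat n)) / 2)) \<longlonglongrightarrow> 1 / 2"
    using tendsto_norm by fastforce
  hence "eventually (\<lambda>n. norm (((a + of_nat n) / of_nat n * ((b + of_nat n) / of_nat n)) /
      ((c + of_nat n) / of_nat n * ((1 + of_nat n) / of_nat n)) / 2) < 3/4) sequentially"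
    by (rule order_tendstoD) simp
  \<comment> \<open>Beyond \<open>norm c\<close> the factor \<open>c + of_nat n\<close> cannot
    vanish, so the term quotient makes sense even if \<open>c\<close> is a non-positive
    integer.\<close>
  moreover have "eventually (\<lambda>n. of_nat n > norm c) sequentially"
    using filterlim_at_top_dense filterlim_real_sequentially by blast
  ultimately have "eventually (\<lambda>n. norm (regF_term a b c (Suc n)) \<le> 3/4 * norm (regF_term a b c n)) sequentially"
    using eventually_gt_at_top[of 0]
  proof eventually_elim
    case (elim n)
    have cn: "c + of_nat n \<noteq> 0"
      using elim(2) by (metis add.commute add_eq_0_iff norm_minus_cancel norm_of_nat order_less_irrefl)
    have n1: "1 + of_nat n \<noteq> (0::complex)"
      by (rule one_plus_of_nat_ne_0)
    hence n2: "2 + of_nat n * 2 \<noteq> (0::complex)"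
      by (metis distrib_right mult_1 mult_eq_0_iff zero_neq_numeral)
    have "regF_term a b c (Suc n) = (a + of_nat n) * (b + of_nat n) / ((c + of_nat n) * (1 + of_nat n)) / 2
            * regF_term a b c n"
      unfolding regF_term_def rGamma_shift[of c n] pochhammer_Suc fact_Suc of_nat_mult using cn n1 n2
      by (simp add: divide_simps)
    also have "(a + of_nat n) * (b + of_nat n) / ((c + of_nat n) * (1 + of_nat n)) =
       ((a + of_nat n) / of_nat n * ((b + of_nat n) / of_nat n)) /
      ((c + of_nat n) / of_nat n * ((1 + of_nat n) / of_nat n))"
      using elim(3) by simp
    finally have "norm (regF_term a b c (Suc n)) = norm (((a + of_nat n) / of_nat n * ((b + of_nat n) / of_nat n)) /
      ((c + of_nat n) / of_nat n * ((1 + of_nat n) / of_nat n)) / 2) * norm (regF_term a b c n)"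
      by (simp only: norm_mult)
    thus ?case using elim(1)
      by (metis less_eq_real_def mult_right_mono norm_ge_zero)
  qed
  then obtain N where "\<And>n. n \<ge> N \<Longrightarrow> norm (regF_term a b c (Suc n)) \<le> 3/4 * norm (regF_term a b c n)"
    unfolding eventually_sequentially by blast
  thus ?thesis
    by (intro summable_ratio_test[of "3/4" N]) auto
qed

lemma regF_sums: "regF_term a b c sums regF a b c"
  unfolding regF_def by (intro summable_sums summable_norm_cancel[OF summable_norm_regF_term])

section \<open>Contiguity relations\<close>

text \<open>Holds term by term: \<open>a * pochhammer (a + 1) n\<close> is
  \<open>pochhammer a n * (a + of_nat n)\<close>, and a + n splits as (c + n) - (c - a), where c + n
  lowers the argument of \<open>rGamma\<close> by one.\<close>

lemma regF_raise_numerator: "a * regF (a + 1) b (c + 1) = regF a b c - (c - a) * regF a b (c + 1)"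
proof -
  have "a * regF_term (a + 1) b (c + 1) n = regF_term a b c n - (c - a) * regF_term a b (c + 1) n" for n
  proof -
    have "a * pochhammer (a + 1) n = pochhammer a n * (a + of_nat n)"
      by (metis pochhammer_rec pochhammer_Suc)
    hence "a * regF_term (a + 1) b (c + 1) n =
        pochhammer a n * (a + of_nat n) * pochhammer b n * rGamma (c + 1 + of_nat n) / fact n / 2 ^ n"
      by (simp add: regF_term_def mult.assoc[symmetric])
    also have "\<dots> = regF_term a b c n - (c - a) * regF_term a b (c + 1) n"
      unfolding regF_term_def rGamma_shift[of c n]
      by (simp add: add_ac) (simp add: divide_simps algebra_simps)
    finally show ?thesis .
  qed
  moreover have "(\<lambda>n. regF_term a b c n - (c - a) * regF_term a b (c + 1) n) sums
      (regF a b c - (c - a) * regF a b (c + 1))"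
    by (intro sums_diff sums_mult regF_sums)
  ultimately show ?thesis
    using sums_mult[OF regF_sums[of "a + 1" b "c + 1"], of a] by (simp add: sums_unique2)
qed

text \<open>The difference of the series with \<open>b\<close> and \<open>b - 1\<close> is an
  index-shifted series with \<open>a + 1\<close> and \<open>c + 1\<close>, which
  \<open>regF_raise_numerator\<close> then eliminates.\<close>

lemma regF_lower_numerator: "2 * regF a (b - 1) c = regF a b c + (c - a) * regF a b (c + 1)"
proof -
  define X where "X n = regF_term a b c n - regF_term a (b - 1) c n" for n
  \<comment> \<open>The difference (b)_(n+1) - (b-1)_(n+1) equals (n+1) (b)_n; the factor n+1
    reduces the factorial, and the shift of the power of 2 leaves 1/2.\<close>
  have "X (Suc n) = a / 2 * regF_term (a + 1) b (c + 1) n" for n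
  proof -
    have n1: "1 + of_nat n \<noteq> (0::complex)"
      by (rule one_plus_of_nat_ne_0)
    have "pochhammer (b - 1) (Suc n) = (b - 1) * pochhammer b n"
      using pochhammer_rec[of "b - 1" n] by simp
    hence "X (Suc n) = a * pochhammer (a + 1) n * ((1 + of_nat n) * pochhammer b n) * rGamma (c + of_nat (Suc n))
        / fact (Suc n) / 2 ^ Suc n"
      unfolding X_def regF_term_def pochhammer_rec[of a] pochhammer_Suc[of b]
      by (simp add: divide_simps) (simp add: algebra_simps)
    also have "\<dots> = a / 2 * regF_term (a + 1) b (c + 1) n"
      using n1 by (simp add: regF_term_def add_ac divide_simps)
    finally show ?thesis .
  qed
  hence "(\<lambda>n. X (Suc n)) sums (a / 2 * regF (a + 1) b (c + 1))"
    using sums_mult[OF regF_sums, of "a / 2" "a + 1" b "c + 1"] by (simp only:)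
  moreover have "X 0 = 0" by (simp add: X_def regF_term_def)
  ultimately have "X sums (a / 2 * regF (a + 1) b (c + 1))"
    using sums_Suc_iff[of X] by simp
  moreover have "X sums (regF a b c - regF a (b - 1) c)"
    unfolding X_def by (intro sums_diff regF_sums)
  ultimately have "regF a b c - regF a (b - 1) c = a / 2 * regF (a + 1) b (c + 1)"
    using sums_unique2 by blast
  hence "2 * regF a (b - 1) c = 2 * regF a b c - a * regF (a + 1) b (c + 1)"
    by (simp add: field_simps)
  thus ?thesis unfolding regF_raise_numerator by (simp add: algebra_simps)
qed

text \<open>The contiguity relation in \<open>c\<close> has three terms; the middle one vanishes when \<open>a + b = 1\<close> and
  the argument is \<open>1/2\<close>, which is what makes Bailey's closed form possible.\<close>
lemma regF_raise_denominator:
  "regF a (1 - a) c = (c + 1 - a) * (c + a) * regF a (1 - a) (c + 2)"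
proof -
  define b where "b = 1 - a"
  \<comment> \<open>Since \<open>rGamma (c + of_nat n)\<close> is (c + n)
    \<open>rGamma (c + 1 + of_nat n)\<close>, the term \<open>X n\<close> carries a factor n and can
    be shifted. \<open>Y n\<close> is the shifted term, with (a + n)(b + n) expanded in (c + n)(c +
    n + 1), c + n + 1 and 1.\<close>
  define X where "X n = regF_term a b c n - c * regF_term a b (c + 1) n" for n
  define Y where "Y n = (regF_term a b c n - 2 * c * regF_term a b (c + 1) n
     + (c + 1 - a) * (c + a) * regF_term a b (c + 2) n) / 2" for n
  have "X (Suc n) = Y n" for n
  proof -
    have n1: "1 + of_nat n \<noteq> (0::complex)"
      by (rule one_plus_of_nat_ne_0)
    define g where "g = rGamma (c + 2 + of_nat n)"
    have g: "rGamma (c + 1 + of_nat n) = (c + 1 + of_nat n) * g" "rGamma (c + 1 + of_nat (Suc n)) = g"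
       "rGamma (c + of_nat (Suc n)) = (c + 1 + of_nat n) * g"
       "rGamma (c + of_nat n) = (c + of_nat n) * ((c + 1 + of_nat n) * g)"
      using rGamma_plus1[of "c + 1 + of_nat n"] rGamma_plus1[of "c + of_nat n"]
      by (simp_all add: g_def add_ac)
    have "X (Suc n) = pochhammer a n * (a + of_nat n) * (pochhammer b n * (b + of_nat n)) * ((1 + of_nat n) * g)
            / fact (Suc n) / 2 ^ Suc n"
      unfolding X_def regF_term_def g pochhammer_Suc by (simp add: divide_simps) (simp add: algebra_simps)
    also have "\<dots> = pochhammer a n * pochhammer b n * ((a + of_nat n) * (b + of_nat n) * g) / fact n / 2 ^ Suc n"
      using n1 by simp
    also have "\<dots> = Y n"
      unfolding Y_def regF_term_def g g_def[symmetric]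
      by (simp add: divide_simps) (simp add: b_def algebra_simps)
    finally show ?thesis .
  qed
  hence "(\<lambda>n. X (Suc n)) sums ((regF a b c - 2 * c * regF a b (c + 1)
     + (c + 1 - a) * (c + a) * regF a b (c + 2)) / 2)"
    by (simp only:) (unfold Y_def, intro sums_divide sums_add sums_diff sums_mult regF_sums)
  moreover have "X 0 = 0"
    using rGamma_plus1[of c] by (simp add: X_def regF_term_def)
  ultimately have "X sums ((regF a b c - 2 * c * regF a b (c + 1)
     + (c + 1 - a) * (c + a) * regF a b (c + 2)) / 2)"
    using sums_Suc_iff[of X] by simp
  moreover have "X sums (regF a b c - c * regF a b (c + 1))"
    unfolding X_def by (intro sums_diff sums_mult regF_sums)
  \<comment> \<open>Two evaluations of the sum of \<open>X\<close>: both contain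
    \<open>c * regF a b (c + 1)\<close> with the same sign, so it cancels.\<close>
  ultimately have "regF a b c - c * regF a b (c + 1) = (regF a b c - 2 * c * regF a b (c + 1)
     + (c + 1 - a) * (c + a) * regF a b (c + 2)) / 2"
    using sums_unique2 by blast
  thus ?thesis by (simp add: b_def field_simps)
qed

section \<open>Behaviour of the series for large denominator parameter\<close>

text \<open>The first factor supplies the decay in \<open>c\<close>; each later factor has norm at
  most 1. The index \<open>Suc n\<close> excludes the empty product, whose ratio is 1.\<close>

lemma norm_pochhammer_ratio_le:
  fixes b c :: complex
  assumes "norm b \<le> Re c" "Re c > 0"
  shows "norm (pochhammer b (Suc n)) / norm (pochhammer c (Suc n)) \<le> norm b / Re c"
proof (induction n)
  case 0
  show ?case using assms complex_Re_le_cmod[of c] by (simp add: frac_le)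
next
  case (Suc n)
  define k where "k = real (Suc n)"
  have "norm (b + of_nat (Suc n)) \<le> norm b + k"
    unfolding k_def by (metis norm_of_nat norm_triangle_ineq)
  also have "\<dots> \<le> Re (c + of_nat (Suc n))" using assms(1) by (simp add: k_def)
  also have "\<dots> \<le> norm (c + of_nat (Suc n))" by (rule complex_Re_le_cmod)
  finally have "norm (b + of_nat (Suc n)) / norm (c + of_nat (Suc n)) \<le> 1"
    by (simp add: divide_le_eq_1)
  with Suc have "norm (pochhammer b (Suc n)) / norm (pochhammer c (Suc n))
      * (norm (b + of_nat (Suc n)) / norm (c + of_nat (Suc n))) \<le> norm b / Re c * 1"
    using assms by (intro mult_mono) auto
  thus ?case by (simp only: pochhammer_Suc[of _ "Suc n"] norm_mult times_divide_times_eq mult_1_right)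
qed

lemma not_nonpos_Int_if_Re_pos: "c \<notin> \<int>\<^sub>\<le>\<^sub>0" if "Re c > 0" for c :: complex
  using that by (auto elim!: nonpos_Ints_cases)

text \<open>After multiplication by \<open>Gamma c\<close> the leading term is 1, and the others are
  dominated by a series independent of \<open>c\<close>: \<open>regF_term a 1 1 n\<close> is just
  (a)_n / (n! 2^n).\<close>

lemma regF_normalized_near_1:
  assumes "norm b \<le> Re c" "Re c > 0"
  shows "norm (Gamma c * regF a b c - 1) \<le> norm b / Re c * (\<Sum>n. norm (regF_term a 1 1 (Suc n)))"
proof -
  have c: "c \<notin> \<int>\<^sub>\<le>\<^sub>0" using assms(2) by (rule not_nonpos_Int_if_Re_pos)
  have term_eq: "Gamma c * regF_term a b c n = regF_term a 1 1 n * (pochhammer b n / pochhammer c n)" for n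
  proof -
    have "rGamma (1 + of_nat n) = inverse (fact n :: complex)"
      by (simp add: rGamma_inverse_Gamma Gamma_fact)
    hence 1: "regF_term a 1 1 n = pochhammer a n / fact n / 2 ^ n"
      by (simp add: regF_term_def pochhammer_fact[symmetric] divide_inverse)
    have "Gamma c * rGamma (c + of_nat n) = 1 / pochhammer c n"
      using c by (rule Gamma_times_rGamma_plus_of_nat)
    hence "Gamma c * regF_term a b c n = pochhammer a n * pochhammer b n * (1 / pochhammer c n) / fact n / 2 ^ n"
      unfolding regF_term_def by (metis (no_types, opaque_lifting) mult.left_commute times_divide_eq_right)
    thus ?thesis unfolding 1 by simp
  qed
  have S: "(\<lambda>n. Gamma c * regF_term a b c n) sums (Gamma c * regF a b c)"
    by (intro sums_mult regF_sums)
  have "Gamma c * regF_term a b c 0 = 1"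
    using c by (simp add: regF_term_def rGamma_inverse_Gamma Gamma_eq_zero_iff)
  hence S1: "(\<lambda>n. Gamma c * regF_term a b c (Suc n)) sums (Gamma c * regF a b c - 1)"
    using S sums_Suc_iff[of "\<lambda>n. Gamma c * regF_term a b c n"] by simp
  have sm: "summable (\<lambda>n. norm (regF_term a 1 1 (Suc n)))"
    using summable_norm_regF_term[of a 1 1] by (subst summable_Suc_iff)
  have le: "norm (Gamma c * regF_term a b c (Suc n)) \<le> norm (regF_term a 1 1 (Suc n)) * (norm b / Re c)" for n
    unfolding term_eq norm_mult norm_divide
    by (intro mult_left_mono norm_pochhammer_ratio_le assms) auto
  have "norm (Gamma c * regF a b c - 1) \<le> (\<Sum>n. norm (regF_term a 1 1 (Suc n)) * (norm b / Re c))"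
    unfolding sums_unique[OF S1] by (rule norm_suminf_le[OF le summable_mult2[OF sm]])
  also have "\<dots> = norm b / Re c * (\<Sum>n. norm (regF_term a 1 1 (Suc n)))"
    using suminf_mult2[OF sm, of "norm b / Re c"] by (simp add: mult.commute)
  finally show ?thesis .
qed

lemma regF_normalized_tendsto_1:
  assumes "filterlim (\<lambda>n. Re (c n)) at_top F"
  shows "((\<lambda>n. Gamma (c n) * regF a b (c n)) \<longlongrightarrow> 1) F"
proof -
  define B where "B = (\<Sum>n. norm (regF_term a 1 1 (Suc n)))"
  have "((\<lambda>n. norm b / Re (c n) * B) \<longlongrightarrow> 0 * B) F"
    by (intro tendsto_mult tendsto_const tendsto_divide_0[OF tendsto_const] filterlim_at_top_imp_at_infinity assms)
  moreover have "eventually (\<lambda>n. norm (Gamma (c n) * regF a b (c n) - 1) \<le> norm b / Re (c n) * B) F"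
  proof -
    have "eventually (\<lambda>n. Re (c n) > norm b) F"
      using assms by (simp add: filterlim_at_top_dense)
    thus ?thesis
    proof eventually_elim
      case (elim n)
      thus ?case unfolding B_def by (intro regF_normalized_near_1) (auto intro: le_less_trans[OF norm_ge_zero])
    qed
  qed
  ultimately show ?thesis
    by (subst LIM_zero_iff[symmetric]) (auto intro: Lim_null_comparison)
qed

section \<open>Bailey's summation theorem\<close>

text \<open>With denominator parameter \<open>e + a\<close> the contiguity factor is (e + 1)(e +
  2a). Its first part is absorbed by \<open>Gamma (e + 2)\<close>, and only the ratio of e/2 + a to
  e/2 remains, so that iteration produces Pochhammer symbols.\<close>

lemma bailey_step:
  assumes e: "e \<notin> \<int>\<^sub>\<le>\<^sub>0"
  shows "Gamma e * regF a (1 - a) (e + a) * (e / 2)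
       = (e / 2 + a) * (Gamma (e + 2) * regF a (1 - a) (e + 2 + a))"
proof -
  have "e + 1 \<notin> \<int>\<^sub>\<le>\<^sub>0" using not_nonpos_Int_plus_of_nat[OF e, of 1] by simp
  hence "Gamma (e + 2) = (e + 1) * (e * Gamma e)"
    using Gamma_plus1[OF e] Gamma_plus1[of "e + 1"] by (simp add: add.assoc)
  thus ?thesis
    unfolding regF_raise_denominator[of a "e + a"] by (simp add: algebra_simps)
qed

lemma bailey_iterate:
  assumes e: "e \<notin> \<int>\<^sub>\<le>\<^sub>0"
  shows "Gamma e * regF a (1 - a) (e + a) * pochhammer (e / 2) N
       = pochhammer (e / 2 + a) N
         * (Gamma (e + of_nat (2 * N)) * regF a (1 - a) (e + of_nat (2 * N) + a))"
proof (induction N)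
  case (Suc N)
  have "e + of_nat (2 * N) \<notin> \<int>\<^sub>\<le>\<^sub>0" using e by (rule not_nonpos_Int_plus_of_nat)
  from bailey_step[OF this, of a]
  have st: "Gamma (e + of_nat (2 * N)) * regF a (1 - a) (e + of_nat (2 * N) + a) * (e / 2 + of_nat N)
    = (e / 2 + a + of_nat N) * (Gamma (e + of_nat (2 * Suc N)) * regF a (1 - a) (e + of_nat (2 * Suc N) + a))"
    by (simp add: add_divide_distrib add_ac)
  have "Gamma e * regF a (1 - a) (e + a) * pochhammer (e / 2) (Suc N) =
    Gamma e * regF a (1 - a) (e + a) * pochhammer (e / 2) N * (e / 2 + of_nat N)"
    by (simp add: pochhammer_Suc)
  also have "\<dots> = pochhammer (e / 2 + a) N * (Gamma (e + of_nat (2 * N)) * regF a (1 - a) (e + of_nat (2 * N) + a) * (e / 2 + of_nat N))"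
    unfolding Suc.IH by (simp only: mult.assoc)
  also have "\<dots> = pochhammer (e / 2 + a) (Suc N) * (Gamma (e + of_nat (2 * Suc N)) * regF a (1 - a) (e + of_nat (2 * Suc N) + a))"
    unfolding st pochhammer_Suc by (simp only: mult.assoc)
  finally show ?case .
qed simp

lemma half_not_nonpos_Int: "e / 2 \<notin> \<int>\<^sub>\<le>\<^sub>0" if "e \<notin> \<int>\<^sub>\<le>\<^sub>0" for e :: complex
proof
  assume "e / 2 \<in> \<int>\<^sub>\<le>\<^sub>0"
  hence "2 * (e / 2) \<in> \<int>\<^sub>\<le>\<^sub>0" by (intro Nats_mult_nonpos_Ints) auto
  thus False using that by simp
qed

text \<open>Isolates the growth n^(u-v) of the ratio; the \<open>rGamma_series\<close> factors
  converge to \<open>rGamma\<close>.\<close>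

lemma pochhammer_ratio_rGamma_series:
  fixes u v :: complex
  shows "pochhammer u (Suc n) / pochhammer v (Suc n) =
     rGamma_series u n / rGamma_series v n * exp ((u - v) * of_real (ln (of_nat n)))"
  by (simp add: rGamma_series_def exp_diff ring_distribs)

text \<open>In \<open>bailey_iterate\<close> the left side is fixed while \<open>N\<close> grows.
  The Pochhammer ratios grow like N^a and (2N)^(-a), so the powers of N cancel and 2^(-a)
  survives.\<close>

lemma bailey_if_denominator_admissible:
  assumes e: "e \<notin> \<int>\<^sub>\<le>\<^sub>0" and c: "e + a \<notin> \<int>\<^sub>\<le>\<^sub>0"
  shows "2 powr a * Gamma e * regF a (1 - a) (e + a) = Gamma (e / 2) * rGamma (e / 2 + a)"
proof -
  define x where "x = e / 2"
  define c where "c = e + a"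
  have x: "x \<notin> \<int>\<^sub>\<le>\<^sub>0" unfolding x_def using e by (rule half_not_nonpos_Int)
  define q where "q N = Gamma (c + of_nat (2 * N)) * regF a (1 - a) (c + of_nat (2 * N))" for N
  have lq: "q \<longlonglongrightarrow> 1"
    unfolding q_def
  proof (rule regF_normalized_tendsto_1)
    have "filterlim (\<lambda>N. Re c + real (2 * N)) at_top sequentially"
      by (intro filterlim_tendsto_add_at_top[OF tendsto_const]
          filterlim_compose[OF filterlim_real_sequentially] mult_nat_left_at_top) simp
    thus "filterlim (\<lambda>N. Re (c + of_nat (2 * N))) at_top sequentially" by simp
  qed
  define f where "f = Gamma e * regF a (1 - a) c"
  \<comment> \<open>The quotient of the symbols for \<open>e\<close> and \<open>c\<close> replaces
    \<open>Gamma (e + of_nat (2 * N))\<close> by \<open>Gamma (c + of_nat (2 * N))\<close>, the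
    normalisation for which \<open>q\<close> tends to 1.\<close>
  have f_eq: "f = pochhammer (x + a) N / pochhammer x N * (pochhammer e (2 * N) / pochhammer c (2 * N))
         * (Gamma e / Gamma c) * q N" for N
  proof -
    have cN: "c + of_nat (2 * N) \<notin> \<int>\<^sub>\<le>\<^sub>0" using c unfolding c_def by (rule not_nonpos_Int_plus_of_nat)
    have 1: "Gamma (e + of_nat (2 * N)) = Gamma e * pochhammer e (2 * N)"
      using pochhammer_Gamma[OF e, of "2 * N"] e by (simp add: Gamma_eq_zero_iff)
    have 2: "Gamma (c + of_nat (2 * N)) = Gamma c * pochhammer c (2 * N)"
      using pochhammer_Gamma[of c "2 * N"] c by (simp add: Gamma_eq_zero_iff c_def)
    have px: "pochhammer x N \<noteq> 0" using x by (rule pochhammer_ne_0)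
    have "f * pochhammer x N = pochhammer (x + a) N * (Gamma (e + of_nat (2 * N)) * regF a (1 - a) (c + of_nat (2 * N)))"
      using bailey_iterate[OF e, of a N] by (simp add: f_def c_def x_def add_ac)
    hence "f = pochhammer (x + a) N / pochhammer x N * (Gamma (e + of_nat (2 * N)) * regF a (1 - a) (c + of_nat (2 * N)))"
      using px by (simp add: field_simps)
    also have "regF a (1 - a) (c + of_nat (2 * N)) = q N / (Gamma c * pochhammer c (2 * N))"
      using cN by (simp add: q_def 2[symmetric] Gamma_eq_zero_iff)
    finally show ?thesis unfolding 1 by (simp add: field_simps)
  qed
  \<comment> \<open>\<open>E n\<close> is (n / (2n + 1))^a. The index 2n + 1 arises because
    \<open>rGamma_series\<close> at n involves a Pochhammer symbol of length n + 1: for N = n + 1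
    the length 2N belongs to index 2n + 1.\<close>
  define E where "E n = exp (- a * of_real (ln (2 + 1 / real n)))" for n :: nat
  have lE: "E \<longlonglongrightarrow> exp (- a * of_real (ln (2 + 0)))"
    unfolding E_def by (intro tendsto_intros lim_1_over_n) auto
  have E_eq: "exp (a * of_real (ln (real n))) * exp (- a * of_real (ln (real (2 * n + 1)))) = E n" if "n > 0" for n
  proof -
    have "real (2 * n + 1) = real n * (2 + 1 / real n)" using that by (simp add: field_simps)
    hence "ln (real (2 * n + 1)) = ln (real n) + ln (2 + 1 / real n)"
      using that ln_mult_pos[of "real n" "2 + 1 / real n"] by (simp add: add_pos_pos)
    thus ?thesis by (simp add: E_def exp_add[symmetric] algebra_simps)
  qed
  define R where "R n = rGamma_series (x + a) n / rGamma_series x n *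
    (rGamma_series e (2 * n + 1) / rGamma_series c (2 * n + 1)) * (Gamma e / Gamma c) * E n * q (Suc n)" for n
  have sub: "filterlim (\<lambda>n::nat. 2 * n + 1) at_top sequentially"
    by (rule filterlim_subseq) (auto simp: strict_mono_def)
  have "R \<longlonglongrightarrow> rGamma (x + a) / rGamma x * (rGamma e / rGamma c) * (Gamma e / Gamma c) * exp (- a * of_real (ln (2 + 0))) * 1"
    unfolding R_def
    using x e c
    by (intro tendsto_mult tendsto_divide tendsto_const rGamma_series_LIMSEQ lE LIMSEQ_Suc[OF lq]
         filterlim_compose[OF rGamma_series_LIMSEQ sub]) (auto simp: rGamma_eq_zero_iff c_def)
  moreover have "eventually (\<lambda>n. R n = f) sequentially"
    using eventually_gt_at_top[of 0]
  proof eventually_elim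
    case (elim n)
    have A: "pochhammer (x + a) (Suc n) / pochhammer x (Suc n) =
      rGamma_series (x + a) n / rGamma_series x n * exp (a * of_real (ln (real n)))"
      unfolding pochhammer_ratio_rGamma_series by simp
    have B: "pochhammer e (2 * Suc n) / pochhammer c (2 * Suc n) =
      rGamma_series e (2 * n + 1) / rGamma_series c (2 * n + 1) * exp (- a * of_real (ln (real (2 * n + 1))))"
      using pochhammer_ratio_rGamma_series[of e "2 * n + 1" c] by (simp add: c_def)
    show "R n = f"
      unfolding f_eq[of "Suc n"] A B R_def E_eq[OF elim, symmetric] by simp
  qed
  ultimately have "(\<lambda>n. f) \<longlonglongrightarrow> rGamma (x + a) / rGamma x * (rGamma e / rGamma c) * (Gamma e / Gamma c) * exp (- a * of_real (ln (2 + 0))) * 1"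
    by (rule Lim_transform_eventually)
  hence "f = rGamma (x + a) / rGamma x * (rGamma e / rGamma c) * (Gamma e / Gamma c) * exp (- a * of_real (ln (2 + 0)))"
    by (simp add: LIMSEQ_const_iff)
  also have "\<dots> = rGamma (x + a) * Gamma x * exp (- a * of_real (ln 2))"
    using e c by (simp add: rGamma_inverse_Gamma Gamma_eq_zero_iff field_simps c_def)
  also have "exp (- a * of_real (ln 2)) = inverse (2 powr a)"
    using Ln_of_real[of 2] by (simp add: powr_def exp_minus)
  finally show ?thesis
    by (simp add: f_def x_def c_def field_simps)
qed

text \<open>Bailey's summation theorem, with \<open>c = e + a\<close> and the duplication formula already applied.\<close>
lemma bailey:
  assumes "e \<notin> \<int>\<^sub>\<le>\<^sub>0"
  shows "2 powr a * Gamma e * regF a (1 - a) (e + a) = Gamma (e / 2) * rGamma (e / 2 + a)"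
proof -
  \<comment> \<open>Moving \<open>e\<close> up by \<open>2 * N\<close> gives the denominator
    parameter positive real part; \<open>bailey_iterate\<close> carries the result back down to
    \<open>e\<close>.\<close>
  obtain N :: nat where N: "real N > - Re (e + a)"
    using reals_Archimedean2 by blast
  hence "Re (e + of_nat (2 * N) + a) > 0"
    by simp
  hence c: "e + of_nat (2 * N) + a \<notin> \<int>\<^sub>\<le>\<^sub>0" by (rule not_nonpos_Int_if_Re_pos)
  have eN: "e + of_nat (2 * N) \<notin> \<int>\<^sub>\<le>\<^sub>0" using assms by (rule not_nonpos_Int_plus_of_nat)
  have x: "e / 2 \<notin> \<int>\<^sub>\<le>\<^sub>0" using assms by (rule half_not_nonpos_Int)
  have px: "pochhammer (e / 2) N \<noteq> 0" using x by (rule pochhammer_ne_0)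
  have "2 powr a * Gamma e * regF a (1 - a) (e + a) * pochhammer (e / 2) N =
    pochhammer (e / 2 + a) N * (2 powr a * Gamma (e + of_nat (2 * N)) * regF a (1 - a) (e + of_nat (2 * N) + a))"
    using bailey_iterate[OF assms, of a N] by (simp add: mult_ac)
  also have "\<dots> = Gamma (e / 2 + of_nat N) * (pochhammer (e / 2 + a) N * rGamma (e / 2 + a + of_nat N))"
    unfolding bailey_if_denominator_admissible[OF eN c] by (simp add: add_divide_distrib mult_ac add_ac)
  also have "\<dots> = Gamma (e / 2) * rGamma (e / 2 + a) * pochhammer (e / 2) N"
    unfolding pochhammer_rGamma[symmetric] using pochhammer_Gamma[OF x, of N] x
    by (simp add: Gamma_eq_zero_iff)
  finally show ?thesis using px by simp
qed

section \<open>Extension to the contiguous cases\<close>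

text \<open>With T the shift of e by 1, the step is multiplication by 1 + s T, and the sum is the
  binomial expansion of its i-th power.\<close>

lemma binomial_recurrence:
  fixes W :: "nat \<Rightarrow> complex \<Rightarrow> complex"
  assumes step: "\<And>i e. e \<notin> \<int>\<^sub>\<le>\<^sub>0 \<Longrightarrow> W (Suc i) e = W i e + s * W i (e + 1)"
    and e: "e \<notin> \<int>\<^sub>\<le>\<^sub>0"
  shows "W i e = (\<Sum>r\<le>i. s ^ r * of_nat (i choose r) * W 0 (e + of_nat r))"
  using e
proof (induction i arbitrary: e)
  case 0
  show ?case by simp
next
  case (Suc i)
  have e1: "e + 1 \<notin> \<int>\<^sub>\<le>\<^sub>0" using not_nonpos_Int_plus_of_nat[OF Suc.prems, of 1] by simp
  define g where "g r = s ^ r * W 0 (e + of_nat r)" for r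
  have "W (Suc i) e = (\<Sum>r\<le>i. of_nat (i choose r) * g r) + (\<Sum>r\<le>i. of_nat (i choose r) * g (Suc r))"
    unfolding step[OF Suc.prems] Suc.IH[OF Suc.prems] Suc.IH[OF e1] g_def
    by (simp add: sum_distrib_left mult_ac add_ac)
  \<comment> \<open>Appending the vanishing term \<open>r = Suc i\<close> and splitting off
    \<open>r = 0\<close> aligns the two sums for Pascal's rule.\<close>
  also have "(\<Sum>r\<le>i. of_nat (i choose r) * g r) = g 0 + (\<Sum>r\<le>i. of_nat (i choose Suc r) * g (Suc r))"
  proof -
    have "(\<Sum>r\<le>i. of_nat (i choose r) * g r) = (\<Sum>r\<le>Suc i. of_nat (i choose r) * g r)"
      by simp
    also have "\<dots> = g 0 + (\<Sum>r\<le>i. of_nat (i choose Suc r) * g (Suc r))"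
      by (subst sum.atMost_Suc_shift) simp
    finally show ?thesis .
  qed
  also have "g 0 + (\<Sum>r\<le>i. of_nat (i choose Suc r) * g (Suc r)) + (\<Sum>r\<le>i. of_nat (i choose r) * g (Suc r))
     = g 0 + (\<Sum>r\<le>i. of_nat (Suc i choose Suc r) * g (Suc r))"
    by (simp add: sum.distrib algebra_simps)
  also have "\<dots> = (\<Sum>r\<le>Suc i. of_nat (Suc i choose r) * g r)"
    by (subst sum.atMost_Suc_shift) simp
  finally show ?case by (simp add: g_def mult_ac)
qed

text \<open>The power of 2 absorbs the factor 2 of \<open>regF_lower_numerator\<close>. The
  coefficient there is \<open>e\<close>, and e Gamma(e) = Gamma(e + 1) turns the second term into
  the same expression at \<open>e + 1\<close>.\<close>

lemma bailey_contiguous_minus: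
  assumes e: "e \<notin> \<int>\<^sub>\<le>\<^sub>0"
  shows "2 powr (a + of_nat i) * Gamma e * regF a (1 - a - of_nat i) (e + a) =
    (\<Sum>r\<le>i. of_nat (i choose r) * Gamma ((e + of_nat r) / 2) * rGamma ((e + of_nat r) / 2 + a))"
proof -
  define W where "W i e = 2 powr (a + of_nat i) * Gamma e * regF a (1 - a - of_nat i) (e + a)" for i e
  have W0: "W 0 e = Gamma (e / 2) * rGamma (e / 2 + a)" if "e \<notin> \<int>\<^sub>\<le>\<^sub>0" for e
    using bailey[OF that] by (simp add: W_def)
  have "W (Suc i) e = W i e + 1 * W i (e + 1)" if "e \<notin> \<int>\<^sub>\<le>\<^sub>0" for i e
  proof -
    have p: "2 powr (a + of_nat (Suc i)) = 2 powr (a + of_nat i) * 2"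
      by (simp add: powr_add add_ac)
    have "2 * regF a (1 - a - of_nat (Suc i)) (e + a) =
        regF a (1 - a - of_nat i) (e + a) + e * regF a (1 - a - of_nat i) (e + a + 1)"
      using regF_lower_numerator[of a "1 - a - of_nat i" "e + a"] by (simp add: algebra_simps)
    moreover have "W (Suc i) e = 2 powr (a + of_nat i) * Gamma e *
        (2 * regF a (1 - a - of_nat (Suc i)) (e + a))"
      unfolding W_def p by (simp only: mult_ac)
    ultimately have "W (Suc i) e = 2 powr (a + of_nat i) * Gamma e *
        (regF a (1 - a - of_nat i) (e + a) + e * regF a (1 - a - of_nat i) (e + a + 1))"
      by (simp only:)
    also have "\<dots> = W i e + 1 * W i (e + 1)"
      using Gamma_plus1[OF that] by (simp add: W_def algebra_simps)
    finally show ?thesis .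
  qed
  from binomial_recurrence[where W = W and s = 1, OF this e, of i]
  have "W i e = (\<Sum>r\<le>i. of_nat (i choose r) * W 0 (e + of_nat r))"
    by simp
  thus ?thesis
    using W0[OF not_nonpos_Int_plus_of_nat[OF e]] by (simp add: W_def mult_ac)
qed

text \<open>Here \<open>pochhammer a i\<close> absorbs the factor a + i of
  \<open>regF_raise_numerator\<close>. Raising both parameters together keeps the coefficient equal
  to \<open>e\<close>; its minus sign causes the alternation.\<close>

lemma bailey_contiguous_plus:
  assumes e: "e \<notin> \<int>\<^sub>\<le>\<^sub>0"
  shows "2 powr a * pochhammer a i * Gamma e * regF (a + of_nat i) (1 - a) (e + a + of_nat i) =
    (\<Sum>r\<le>i. (- 1) ^ r * of_nat (i choose r) * Gamma ((e + of_nat r) / 2) * rGamma ((e + of_nat r) / 2 + a))"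
proof -
  define W where "W i e = 2 powr a * pochhammer a i * Gamma e * regF (a + of_nat i) (1 - a) (e + a + of_nat i)" for i e
  have W0: "W 0 e = Gamma (e / 2) * rGamma (e / 2 + a)" if "e \<notin> \<int>\<^sub>\<le>\<^sub>0" for e
    using bailey[OF that] by (simp add: W_def)
  have "W (Suc i) e = W i e + (- 1) * W i (e + 1)" if "e \<notin> \<int>\<^sub>\<le>\<^sub>0" for i e
  proof -
    have "(a + of_nat i) * regF (a + of_nat (Suc i)) (1 - a) (e + a + of_nat (Suc i)) =
        regF (a + of_nat i) (1 - a) (e + a + of_nat i) - e * regF (a + of_nat i) (1 - a) (e + a + of_nat i + 1)"
      using regF_raise_numerator[of "a + of_nat i" "1 - a" "e + a + of_nat i"] by (simp add: add_ac)
    moreover have "W (Suc i) e = 2 powr a * pochhammer a i * Gamma e *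
        ((a + of_nat i) * regF (a + of_nat (Suc i)) (1 - a) (e + a + of_nat (Suc i)))"
      unfolding W_def pochhammer_Suc by (simp only: mult_ac)
    ultimately have "W (Suc i) e = 2 powr a * pochhammer a i * Gamma e *
        (regF (a + of_nat i) (1 - a) (e + a + of_nat i) - e * regF (a + of_nat i) (1 - a) (e + a + of_nat i + 1))"
      by (simp only:)
    also have "\<dots> = W i e + (- 1) * W i (e + 1)"
      using Gamma_plus1[OF that] by (simp add: W_def algebra_simps)
    finally show ?thesis .
  qed
  from binomial_recurrence[where W = W and s = "- 1", OF this e, of i]
  have "W i e = (\<Sum>r\<le>i. (- 1) ^ r * of_nat (i choose r) * W 0 (e + of_nat r))"
    by simp
  thus ?thesis
    using W0[OF not_nonpos_Int_plus_of_nat[OF e]] by (simp add: W_def mult_ac)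
qed

section \<open>Coefficients of the double series along the diagonals\<close>

text \<open>The Taylor coefficients of 2F1(p, q; r; z).\<close>

definition F_coeff :: "complex \<Rightarrow> complex \<Rightarrow> complex \<Rightarrow> nat \<Rightarrow> complex" where
  "F_coeff p q r n = pochhammer p n * pochhammer q n / (pochhammer r n * fact n)"

lemma F_coeff_Suc:
  "F_coeff p q r (Suc n) = F_coeff p q r n * ((p + of_nat n) * (q + of_nat n) / ((r + of_nat n) * (1 + of_nat n)))"
  by (simp add: F_coeff_def pochhammer_Suc mult_ac)

text \<open>Coefficient form of the derivative formula for 2F1.\<close>

lemma F_coeff_Suc_shift:
  "of_nat (Suc n) * F_coeff p q r (Suc n) = p * q / r * F_coeff (p + 1) (q + 1) (r + 1) n"
proof -
  have n1: "1 + of_nat n \<noteq> (0::complex)"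
    by (rule one_plus_of_nat_ne_0)
  show ?thesis
    using n1 by (simp add: F_coeff_def pochhammer_rec)
qed

text \<open>Pfaff-Saalschuetz fits the exponent \<delta> + 1. Writing (1 - z)^(-\<delta>) as (1 - z)
  (1 - z)^(-\<delta>-1) turns its closed form into a difference of consecutive coefficients.\<close>

lemma sum_pochhammer_pred_F_coeff:
  assumes d: "d \<notin> \<int>\<^sub>\<le>\<^sub>0" and \<delta>: "\<delta> + 1 = d - \<gamma> - b"
  shows "(\<Sum>n\<le>Suc N. pochhammer \<delta> (Suc N - n) / fact (Suc N - n) * F_coeff \<gamma> b d n)
       = F_coeff (d - \<gamma>) (d - b) d (Suc N) - F_coeff (d - \<gamma>) (d - b) d N"
proof -
  define D where "D m = pochhammer (\<delta> + 1) m / fact m" for m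
  have S: "(\<Sum>n\<le>N. D (N - n) * F_coeff \<gamma> b d n) = F_coeff (d - \<gamma>) (d - b) d N" for N
    using pfaff_saalschuetz[OF d, of \<gamma> b N] unfolding D_def \<delta> F_coeff_def .
  have D: "pochhammer \<delta> (Suc m) / fact (Suc m) = D (Suc m) - D m" for m
  proof -
    have n1: "1 + of_nat m \<noteq> (0::complex)"
      by (rule one_plus_of_nat_ne_0)
    show ?thesis unfolding D_def pochhammer_rec[of \<delta>] pochhammer_Suc[of "\<delta> + 1"] fact_Suc
      using n1 by (simp add: divide_simps) (simp add: algebra_simps)
  qed
  have "(\<Sum>n\<le>Suc N. pochhammer \<delta> (Suc N - n) / fact (Suc N - n) * F_coeff \<gamma> b d n)
     = (\<Sum>n\<le>N. (D (Suc N - n) - D (N - n)) * F_coeff \<gamma> b d n) + F_coeff \<gamma> b d (Suc N)"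
  proof -
    have "pochhammer \<delta> (Suc N - n) / fact (Suc N - n) = D (Suc N - n) - D (N - n)" if "n \<le> N" for n
      using that D[of "N - n"] by (simp add: Suc_diff_le)
    hence "(\<Sum>n\<le>N. pochhammer \<delta> (Suc N - n) / fact (Suc N - n) * F_coeff \<gamma> b d n)
        = (\<Sum>n\<le>N. (D (Suc N - n) - D (N - n)) * F_coeff \<gamma> b d n)"
      by (intro sum.cong) (simp_all only: atMost_iff)
    thus ?thesis by simp
  qed
  also have "\<dots> = (\<Sum>n\<le>Suc N. D (Suc N - n) * F_coeff \<gamma> b d n) - (\<Sum>n\<le>N. D (N - n) * F_coeff \<gamma> b d n)"
    by (simp add: sum_subtractf left_diff_distrib D_def)
  finally show ?thesis unfolding S .
qed

text \<open>The weight n acts as z d/dz, which raises all three parameters by 1. The parametric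
  excess drops to exactly \<delta>, so Pfaff-Saalschuetz applies directly.\<close>

lemma sum_pochhammer_index_F_coeff:
  assumes d: "d \<notin> \<int>\<^sub>\<le>\<^sub>0" and \<delta>: "\<delta> + 1 = d - \<gamma> - b"
  shows "(\<Sum>n\<le>Suc N. pochhammer \<delta> (Suc N - n) / fact (Suc N - n) * (of_nat n * F_coeff \<gamma> b d n))
       = \<gamma> * b / d * F_coeff (d - \<gamma>) (d - b) (d + 1) N"
proof -
  have d1: "d + 1 \<notin> \<int>\<^sub>\<le>\<^sub>0" using not_nonpos_Int_plus_of_nat[OF d, of 1] by simp
  have \<delta>': "\<delta> = d + 1 - (\<gamma> + 1) - (b + 1)"
    using \<delta> by (simp add: algebra_simps)
  have "(\<Sum>n\<le>Suc N. pochhammer \<delta> (Suc N - n) / fact (Suc N - n) * (of_nat n * F_coeff \<gamma> b d n))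
    = (\<Sum>n\<le>N. pochhammer \<delta> (N - n) / fact (N - n) * (of_nat (Suc n) * F_coeff \<gamma> b d (Suc n)))"
    by (subst sum.atMost_Suc_shift) simp
  also have "\<dots> = \<gamma> * b / d * (\<Sum>n\<le>N. pochhammer \<delta> (N - n) / fact (N - n) * F_coeff (\<gamma> + 1) (b + 1) (d + 1) n)"
    unfolding F_coeff_Suc_shift sum_distrib_left by (intro sum.cong) (simp_all add: mult_ac)
  also have "(\<Sum>n\<le>N. pochhammer \<delta> (N - n) / fact (N - n) * F_coeff (\<gamma> + 1) (b + 1) (d + 1) n)
      = F_coeff (d - \<gamma>) (d - b) (d + 1) N"
    unfolding \<delta>' using pfaff_saalschuetz[OF d1, of "\<gamma> + 1" "b + 1" N] by (simp add: F_coeff_def)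
  finally show ?thesis .
qed

text \<open>Coefficient form of
  \<open>F(z, z) = (1 - z) \<^sub>2F\<^sub>1(1 + \<alpha>, d - \<gamma>; d; z)\<close> for the double series at equal arguments.\<close>
lemma kdf_diagonal_sum:
  fixes \<alpha> \<beta> \<gamma> \<delta> :: complex
  defines "b \<equiv> (\<alpha> - \<beta>) / 2" and "d \<equiv> 1 + (\<alpha> + \<beta>) / 2"
  assumes sum: "\<delta> + \<gamma> = \<beta>"
    and \<beta>: "\<beta> \<notin> \<int>\<^sub>\<le>\<^sub>0" and d: "d \<notin> \<int>\<^sub>\<le>\<^sub>0" and \<alpha>: "\<alpha> \<noteq> 0"
  shows "pochhammer \<alpha> (Suc N) / pochhammer \<beta> (Suc N)
      * (\<Sum>n\<le>Suc N. pochhammer \<delta> (Suc N - n) / fact (Suc N - n) * ((1 + 2 * of_nat n / \<alpha>) * F_coeff \<gamma> b d n))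
     = F_coeff (1 + \<alpha>) (d - \<gamma>) d (Suc N) - F_coeff (1 + \<alpha>) (d - \<gamma>) d N"
proof -
  define k where "k = (of_nat N :: complex)"
  define \<epsilon> where "\<epsilon> = d - \<gamma>"
  define C where "C = F_coeff \<epsilon> (1 + \<beta>) d N"
  have k1: "1 + k \<noteq> 0" unfolding k_def by (rule one_plus_of_nat_ne_0)
  have dk: "d + k \<noteq> 0" using d plus_of_nat_eq_0_imp unfolding k_def by blast
  have d0: "d \<noteq> 0" and b0: "\<beta> \<noteq> 0" using d \<beta> by auto
  have pb: "pochhammer (1 + \<beta>) N \<noteq> 0"
    using pochhammer_ne_0[OF \<beta>, of "Suc N"] by (simp add: pochhammer_rec add.commute)
  \<comment> \<open>The closed forms thus have the parameter 1 + \<beta>, which later cancels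
    against \<open>pochhammer \<beta> (Suc N)\<close>.\<close>
  have db: "d - b = 1 + \<beta>" by (simp add: b_def d_def field_simps)
  have \<delta>: "\<delta> + 1 = d - \<gamma> - b" using db sum by (simp add: algebra_simps)
  have Fd: "F_coeff p q (d + 1) N * (d + k) = F_coeff p q d N * d" for p q
  proof -
    have "d * pochhammer (d + 1) N = pochhammer d N * (d + k)"
      unfolding k_def by (metis pochhammer_rec pochhammer_Suc)
    thus ?thesis using d0 dk pochhammer_ne_0[OF d, of N]
      by (auto simp: F_coeff_def divide_simps mult_ac)
  qed
  have Fd': "F_coeff \<epsilon> (1 + \<beta>) (d + 1) N = C * d / (d + k)"
    using Fd[of \<epsilon> "1 + \<beta>"] dk by (simp add: C_def field_simps)
  have "(\<Sum>n\<le>Suc N. pochhammer \<delta> (Suc N - n) / fact (Suc N - n) * ((1 + 2 * of_nat n / \<alpha>) * F_coeff \<gamma> b d n))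
    = (\<Sum>n\<le>Suc N. pochhammer \<delta> (Suc N - n) / fact (Suc N - n) * F_coeff \<gamma> b d n)
     + 2 / \<alpha> * (\<Sum>n\<le>Suc N. pochhammer \<delta> (Suc N - n) / fact (Suc N - n) * (of_nat n * F_coeff \<gamma> b d n))"
    unfolding sum_distrib_left sum.distrib[symmetric]
    by (intro sum.cong) (simp_all add: algebra_simps)
  also have "\<dots> = F_coeff \<epsilon> (1 + \<beta>) d (Suc N) - C + 2 / \<alpha> * (\<gamma> * b / d * F_coeff \<epsilon> (1 + \<beta>) (d + 1) N)"
    unfolding sum_pochhammer_pred_F_coeff[OF d \<delta>] sum_pochhammer_index_F_coeff[OF d \<delta>] db \<epsilon>_def C_def ..
  also have "\<dots> = C * ((\<epsilon> + k) * (1 + \<beta> + k) / ((d + k) * (1 + k)) - 1 + 2 / \<alpha> * (\<gamma> * b / (d + k)))"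
    unfolding F_coeff_Suc Fd' C_def[symmetric] k_def[symmetric] using d0 by (simp add: algebra_simps)
  finally have L: "(\<Sum>n\<le>Suc N. pochhammer \<delta> (Suc N - n) / fact (Suc N - n) * ((1 + 2 * of_nat n / \<alpha>) * F_coeff \<gamma> b d n))
    = C * ((\<epsilon> + k) * (1 + \<beta> + k) / ((d + k) * (1 + k)) - 1 + 2 / \<alpha> * (\<gamma> * b / (d + k)))" .
  have CC: "pochhammer \<alpha> (Suc N) / pochhammer \<beta> (Suc N) * C = \<alpha> / \<beta> * F_coeff (1 + \<alpha>) \<epsilon> d N"
    using pb by (simp add: C_def F_coeff_def pochhammer_rec add.commute)
  \<comment> \<open>As 2b = \<alpha> - \<beta>, the two sides differ by (\<alpha> - \<beta>)(1 +
    k)(\<epsilon> + \<gamma> - d), which is 0. This exchanges the parameter 1 + \<beta> for 1 +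
    \<alpha>.\<close>
  have "\<alpha> * ((\<epsilon> + k) * (1 + \<beta> + k) - (d + k) * (1 + k)) + 2 * (\<gamma> * b) * (1 + k) =
        \<beta> * ((\<epsilon> + k) * (1 + \<alpha> + k) - (d + k) * (1 + k))"
    unfolding \<epsilon>_def b_def d_def by (simp add: field_simps)
  hence "(\<alpha> * ((\<epsilon> + k) * (1 + \<beta> + k) - (d + k) * (1 + k)) + 2 * (\<gamma> * b) * (1 + k)) / (\<beta> * ((d + k) * (1 + k)))
     = (\<beta> * ((\<epsilon> + k) * (1 + \<alpha> + k) - (d + k) * (1 + k))) / (\<beta> * ((d + k) * (1 + k)))"
    by simp
  hence sc: "\<alpha> / \<beta> * ((\<epsilon> + k) * (1 + \<beta> + k) / ((d + k) * (1 + k)) - 1 + 2 / \<alpha> * (\<gamma> * b / (d + k)))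
     = (\<epsilon> + k) * (1 + \<alpha> + k) / ((d + k) * (1 + k)) - 1"
    using \<alpha> b0 dk k1 by (simp add: divide_simps) (simp add: mult_ac)
  have "pochhammer \<alpha> (Suc N) / pochhammer \<beta> (Suc N) * (C * ((\<epsilon> + k) * (1 + \<beta> + k) / ((d + k) * (1 + k)) - 1 + 2 / \<alpha> * (\<gamma> * b / (d + k))))
     = F_coeff (1 + \<alpha>) \<epsilon> d N * (\<alpha> / \<beta> * ((\<epsilon> + k) * (1 + \<beta> + k) / ((d + k) * (1 + k)) - 1 + 2 / \<alpha> * (\<gamma> * b / (d + k))))"
    unfolding mult.assoc[symmetric] CC by (simp only: mult_ac)
  also have "\<dots> = F_coeff (1 + \<alpha>) \<epsilon> d (Suc N) - F_coeff (1 + \<alpha>) \<epsilon> d N"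
    unfolding sc F_coeff_Suc k_def[symmetric] by (simp add: algebra_simps)
  finally show ?thesis unfolding L \<epsilon>_def .
qed

section \<open>Reduction of the double series to a single Gauss series\<close>

text \<open>Unconditional summability permits regrouping by m + n; the pairs (m + n, n) range over
  all (N, n) with n at most N.\<close>

lemma has_sum_diagonal:
  fixes f :: "nat \<times> nat \<Rightarrow> complex"
  assumes "(f has_sum S) UNIV"
  shows "(\<lambda>N. \<Sum>n\<le>N. f (N - n, n)) sums S"
proof -
  have "((\<lambda>(N, n). f (N - n, n)) has_sum S) (SIGMA N:UNIV. {..N})"
    using assms
    by (subst has_sum_reindex_bij_witness[of _ "\<lambda>(m, n). (m + n, n)" "\<lambda>(N, n). (N - n, n)" UNIV f]) auto
  hence "((\<lambda>N. \<Sum>n\<le>N. f (N - n, n)) has_sum S) UNIV"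
    by (rule has_sum_SigmaD) simp
  thus ?thesis by (rule has_sum_imp_sums)
qed

text \<open>The diagonal sums are the coefficients of (1 - z) times a Gauss series; at z = 1/2 the
  first factor is the 1/2 on the right, and \<open>Gamma\<close> undoes the regularisation.\<close>

lemma kdf_eq_regF:
  fixes \<alpha> \<beta> \<gamma> \<delta> :: complex
  assumes sum: "\<delta> + \<gamma> = \<beta>"
    and \<beta>: "\<beta> \<notin> \<int>\<^sub>\<le>\<^sub>0" and \<alpha>: "\<alpha> / 2 \<notin> \<int>\<^sub>\<le>\<^sub>0" and d: "1 + (\<alpha> + \<beta>) / 2 \<notin> \<int>\<^sub>\<le>\<^sub>0"
    and summable: "kdf_term [\<alpha>] [\<delta>] [\<gamma>, 1 + \<alpha>/2, (\<alpha> - \<beta>)/2] [\<beta>] [] [\<alpha>/2, 1 + (\<alpha> + \<beta>)/2] (1/2) (1/2)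
        summable_on UNIV"
  shows "kdf [\<alpha>] [\<delta>] [\<gamma>, 1 + \<alpha>/2, (\<alpha> - \<beta>)/2] [\<beta>] [] [\<alpha>/2, 1 + (\<alpha> + \<beta>)/2] (1/2) (1/2)
     = Gamma (1 + (\<alpha> + \<beta>) / 2) / 2 * regF (1 + \<alpha>) (1 + (\<alpha> + \<beta>) / 2 - \<gamma>) (1 + (\<alpha> + \<beta>) / 2)"
    (is "?K = _")
proof -
  define b where "b = (\<alpha> - \<beta>) / 2"
  define d where "d = 1 + (\<alpha> + \<beta>) / 2"
  have d': "d \<notin> \<int>\<^sub>\<le>\<^sub>0" using d by (simp add: d_def)
  define \<epsilon> where "\<epsilon> = d - \<gamma>"
  define t where "t = kdf_term [\<alpha>] [\<delta>] [\<gamma>, 1 + \<alpha>/2, (\<alpha> - \<beta>)/2] [\<beta>] [] [\<alpha>/2, 1 + (\<alpha> + \<beta>)/2] (1/2) (1/2)"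
  have a0: "\<alpha> \<noteq> 0" using \<alpha> by auto
  define v where "v = F_coeff (1 + \<alpha>) \<epsilon> d"
  have t_eq: "t (m, n) = pochhammer \<alpha> (m + n) / pochhammer \<beta> (m + n) * (pochhammer \<delta> m / fact m *
      ((1 + 2 * of_nat n / \<alpha>) * F_coeff \<gamma> b d n)) / 2 ^ (m + n)" for m n
  proof -
    \<comment> \<open>The parameter pair 1 + \<alpha>/2 over \<alpha>/2 contributes only a factor
      linear in n.\<close>
    have "\<alpha> / 2 * pochhammer (1 + \<alpha> / 2) n = pochhammer (\<alpha> / 2) n * (\<alpha> / 2 + of_nat n)"
      by (metis pochhammer_rec pochhammer_Suc add.commute)
    hence "pochhammer (1 + \<alpha> / 2) n = pochhammer (\<alpha> / 2) n * (1 + 2 * of_nat n / \<alpha>)"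
      using a0 by (simp add: field_simps)
    hence r: "pochhammer (1 + \<alpha> / 2) n / pochhammer (\<alpha> / 2) n = 1 + 2 * of_nat n / \<alpha>"
      using pochhammer_ne_0[OF \<alpha>, of n] by simp
    have "t (m, n) = pochhammer \<alpha> (m + n) / pochhammer \<beta> (m + n) * (pochhammer \<delta> m / fact m *
      (pochhammer (1 + \<alpha> / 2) n / pochhammer (\<alpha> / 2) n * F_coeff \<gamma> b d n)) / 2 ^ (m + n)"
      by (simp add: t_def kdf_term_def F_coeff_def b_def d_def power_add power_divide mult_ac)
    thus ?thesis unfolding r .
  qed
  have diag_Suc: "(\<Sum>n\<le>Suc N. t (Suc N - n, n)) = (v (Suc N) - v N) / 2 ^ Suc N" for N
  proof -
    have "(\<Sum>n\<le>Suc N. t (Suc N - n, n)) = (\<Sum>n\<le>Suc N. pochhammer \<alpha> (Suc N) / pochhammer \<beta> (Suc N) *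
      (pochhammer \<delta> (Suc N - n) / fact (Suc N - n) * ((1 + 2 * of_nat n / \<alpha>) * F_coeff \<gamma> b d n)) / 2 ^ Suc N)"
      by (intro sum.cong refl, subst t_eq) simp
    also have "\<dots> = (pochhammer \<alpha> (Suc N) / pochhammer \<beta> (Suc N) *
      (\<Sum>n\<le>Suc N. pochhammer \<delta> (Suc N - n) / fact (Suc N - n) * ((1 + 2 * of_nat n / \<alpha>) * F_coeff \<gamma> b d n))) / 2 ^ Suc N"
      by (simp only: sum_distrib_left sum_divide_distrib)
    also have "\<dots> = (v (Suc N) - v N) / 2 ^ Suc N"
      unfolding v_def \<epsilon>_def b_def d_def
      by (subst kdf_diagonal_sum[OF sum \<beta> d a0]) (rule refl)
    finally show ?thesis .
  qed
  have diag_0: "(\<Sum>n\<le>0. t (0 - n, n)) = v 0"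
    by (simp add: t_eq v_def F_coeff_def)
  have "(t has_sum ?K) UNIV"
    using summable unfolding kdf_def t_def by (rule has_sum_infsum)
  from has_sum_diagonal[OF this] have "(\<lambda>N. \<Sum>n\<le>N. t (N - n, n)) sums ?K" .
  \<comment> \<open>The difference formula starts at the diagonal 1, so diagonal 0 is split
    off.\<close>
  hence "(\<lambda>N. \<Sum>n\<le>Suc N. t (Suc N - n, n)) sums (?K - v 0)"
    using sums_Suc_iff[of "\<lambda>N. \<Sum>n\<le>N. t (N - n, n)" "?K - v 0"] diag_0 by simp
  hence K: "(\<lambda>N. v (Suc N) / 2 ^ Suc N - v N / 2 ^ N / 2) sums (?K - v 0)"
    unfolding diag_Suc by (simp add: diff_divide_distrib mult_ac)
  define R where "R = Gamma d * regF (1 + \<alpha>) \<epsilon> d"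
  have "(\<lambda>N. v N / 2 ^ N) sums R"
  proof -
    have "Gamma d * regF_term (1 + \<alpha>) \<epsilon> d n = v n / 2 ^ n" for n
    proof -
      have "Gamma d * rGamma (d + of_nat n) = 1 / pochhammer d n"
        using d' by (rule Gamma_times_rGamma_plus_of_nat)
      hence "Gamma d * regF_term (1 + \<alpha>) \<epsilon> d n = pochhammer (1 + \<alpha>) n * pochhammer \<epsilon> n * (1 / pochhammer d n) / fact n / 2 ^ n"
        unfolding regF_term_def by (metis (no_types, opaque_lifting) mult.left_commute times_divide_eq_right)
      thus ?thesis by (simp add: v_def F_coeff_def)
    qed
    thus ?thesis using sums_mult[OF regF_sums[of "1 + \<alpha>" \<epsilon> d], of "Gamma d"] by (simp add: R_def)
  qed
  moreover from this have "(\<lambda>N. v (Suc N) / 2 ^ Suc N) sums (R - v 0)"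
    using sums_Suc_iff[of "\<lambda>N. v N / 2 ^ N" "R - v 0"] by simp
  ultimately have "(\<lambda>N. v (Suc N) / 2 ^ Suc N - v N / 2 ^ N / 2) sums (R - v 0 - R / 2)"
    by (intro sums_diff sums_divide)
  hence "?K - v 0 = R - v 0 - R / 2"
    using K sums_unique2 by blast
  thus ?thesis by (simp add: R_def d_def \<epsilon>_def)
qed

section \<open>The two summation formulas\<close>

theorem theorem6:
  fixes i :: nat and \<alpha> \<beta> :: complex
  assumes den1: "\<beta> \<notin> \<int>\<^sub>\<le>\<^sub>0"
    and den2: "\<alpha> / 2 \<notin> \<int>\<^sub>\<le>\<^sub>0"
    and den3: "1 + (\<alpha> + \<beta>) / 2 \<notin> \<int>\<^sub>\<le>\<^sub>0"
    and gB: "(\<beta> - \<alpha>) / 2 \<notin> \<int>\<^sub>\<le>\<^sub>0"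
    and gC: "\<And>r. r \<le> i \<Longrightarrow> (\<beta> - \<alpha>) / 4 + of_nat r / 2 \<notin> \<int>\<^sub>\<le>\<^sub>0"
  shows
   "((kdf_term [\<alpha>] [\<beta>/2 - 3*\<alpha>/2 - 1 + of_nat i]
        [\<beta>/2 + 3*\<alpha>/2 + 1 - of_nat i, 1 + \<alpha>/2, (\<alpha> - \<beta>)/2]
        [\<beta>] [] [\<alpha>/2, 1 + (\<alpha> + \<beta>)/2] (1/2) (1/2)) summable_on UNIV
     \<and> \<alpha> - of_nat i + 1 \<notin> \<int>\<^sub>\<le>\<^sub>0 \<and> \<alpha> + 1 \<notin> \<int>\<^sub>\<le>\<^sub>0
     \<and> (\<forall>r\<le>i. (\<beta> + 3*\<alpha>)/4 + 1 - of_nat i + of_nat r / 2 \<notin> \<int>\<^sub>\<le>\<^sub>0)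
     \<longrightarrow>
     kdf [\<alpha>] [\<beta>/2 - 3*\<alpha>/2 - 1 + of_nat i]
        [\<beta>/2 + 3*\<alpha>/2 + 1 - of_nat i, 1 + \<alpha>/2, (\<alpha> - \<beta>)/2]
        [\<beta>] [] [\<alpha>/2, 1 + (\<alpha> + \<beta>)/2] (1/2) (1/2)
     = (2 powr (of_nat i - \<alpha> - 2) * Gamma (\<alpha> - of_nat i + 1) * Gamma (1 + (\<alpha> + \<beta>)/2))
         / (Gamma (\<alpha> + 1) * Gamma ((\<beta> - \<alpha>)/2))
       * (\<Sum>r=0..i. (-1)^r * of_nat (i choose r)
            * Gamma ((\<beta> - \<alpha>)/4 + of_nat r / 2)
            / Gamma ((\<beta> + 3*\<alpha>)/4 + 1 - of_nat i + of_nat r / 2)))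
   \<and>
   ((kdf_term [\<alpha>] [\<beta>/2 - 3*\<alpha>/2 - 1 - of_nat i]
        [\<beta>/2 + 3*\<alpha>/2 + 1 + of_nat i, 1 + \<alpha>/2, (\<alpha> - \<beta>)/2]
        [\<beta>] [] [\<alpha>/2, 1 + (\<alpha> + \<beta>)/2] (1/2) (1/2)) summable_on UNIV
     \<and> (\<forall>r\<le>i. (\<beta> + 3*\<alpha>)/4 + 1 + of_nat r / 2 \<notin> \<int>\<^sub>\<le>\<^sub>0)
     \<longrightarrow>
     kdf [\<alpha>] [\<beta>/2 - 3*\<alpha>/2 - 1 - of_nat i]
        [\<beta>/2 + 3*\<alpha>/2 + 1 + of_nat i, 1 + \<alpha>/2, (\<alpha> - \<beta>)/2]
        [\<beta>] [] [\<alpha>/2, 1 + (\<alpha> + \<beta>)/2] (1/2) (1/2)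
     = (2 powr (- of_nat i - \<alpha> - 2) * Gamma (1 + (\<alpha> + \<beta>)/2))
         / Gamma ((\<beta> - \<alpha>)/2)
       * (\<Sum>r=0..i. of_nat (i choose r)
            * Gamma ((\<beta> - \<alpha>)/4 + of_nat r / 2)
            / Gamma ((\<beta> + 3*\<alpha>)/4 + 1 + of_nat r / 2)))"
proof -
  \<comment> \<open>In both cases \<open>e\<close> is the denominator parameter \<open>d\<close>
    minus the first numerator parameter 1 + \<alpha>.\<close>
  define e where "e = (\<beta> - \<alpha>) / 2"
  define d where "d = 1 + (\<alpha> + \<beta>) / 2"
  have e: "e \<notin> \<int>\<^sub>\<le>\<^sub>0" using gB by (simp add: e_def)
  have Ge: "Gamma e \<noteq> 0" using e by (simp add: Gamma_eq_zero_iff)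
  have half: "(\<beta> - \<alpha>) / 4 + of_nat r / 2 = (e + of_nat r) / 2" for r
    by (simp add: e_def field_simps)
  have d_alt: "e + (1 + \<alpha>) = d" by (simp add: e_def d_def field_simps)
  let ?\<gamma>1 = "\<beta>/2 + 3*\<alpha>/2 + 1 - of_nat i" and ?\<delta>1 = "\<beta>/2 - 3*\<alpha>/2 - 1 + of_nat i"
  let ?\<gamma>2 = "\<beta>/2 + 3*\<alpha>/2 + 1 + of_nat i" and ?\<delta>2 = "\<beta>/2 - 3*\<alpha>/2 - 1 - of_nat i"
  have sums: "?\<delta>1 + ?\<gamma>1 = \<beta>" "?\<delta>2 + ?\<gamma>2 = \<beta>" by simp_all
  show ?thesis
  proof (intro conjI impI; (elim conjE)?)
    assume summable: "kdf_term [\<alpha>] [?\<delta>1] [?\<gamma>1, 1 + \<alpha>/2, (\<alpha> - \<beta>)/2] [\<beta>] [] [\<alpha>/2, 1 + (\<alpha> + \<beta>)/2] (1/2) (1/2) summable_on UNIV"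
      and a1: "\<alpha> - of_nat i + 1 \<notin> \<int>\<^sub>\<le>\<^sub>0" "\<alpha> + 1 \<notin> \<int>\<^sub>\<le>\<^sub>0"
    \<comment> \<open>Chosen so that a + i = 1 + \<alpha> and 1 - a = i - \<alpha>, the two
      numerator parameters of the Gauss series.\<close>
    define a where "a = \<alpha> - of_nat i + 1"
    define S where "S = (\<Sum>r=0..i. (-1)^r * of_nat (i choose r)
            * Gamma ((\<beta> - \<alpha>)/4 + of_nat r / 2)
            / Gamma ((\<beta> + 3*\<alpha>)/4 + 1 - of_nat i + of_nat r / 2))"
    have S: "2 powr a * pochhammer a i * Gamma e * regF (1 + \<alpha>) (d - ?\<gamma>1) d = S"
    proof -
      have args: "a + of_nat i = 1 + \<alpha>" "1 - a = d - ?\<gamma>1" "e + a + of_nat i = d"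
        by (simp_all add: a_def d_alt[symmetric] e_def field_simps)
      have "(\<beta> + 3*\<alpha>)/4 + 1 - of_nat i + of_nat r / 2 = (e + of_nat r) / 2 + a" for r
        by (simp add: e_def a_def field_simps)
      thus ?thesis
        using bailey_contiguous_plus[OF e, of a i, unfolded args]
        by (simp only: S_def half[unfolded divide_inverse] atLeast0AtMost rGamma_inverse_Gamma divide_inverse)
    qed
    have Ga: "Gamma a \<noteq> 0" "Gamma (\<alpha> + 1) \<noteq> 0"
      using a1 by (simp_all add: a_def Gamma_eq_zero_iff)
    \<comment> \<open>Source of the Gamma quotient that only the first formula has.\<close>
    have poch: "pochhammer a i = Gamma (\<alpha> + 1) / Gamma a"
      using pochhammer_Gamma[of a i] a1 by (simp add: a_def)
    have pw: "2 powr (of_nat i - \<alpha> - 2) = 1 / (2 * 2 powr a)"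
    proof -
      have "2 powr (of_nat i - \<alpha> - 2) * (2 powr a * 2 powr 1) = (1::complex)"
        unfolding powr_add[symmetric] by (simp add: a_def)
      thus ?thesis by (simp add: field_simps)
    qed
    have "Gamma d / 2 * regF (1 + \<alpha>) (d - ?\<gamma>1) d = (2 powr (of_nat i - \<alpha> - 2) * Gamma a * Gamma d)
         / (Gamma (\<alpha> + 1) * Gamma e) * S"
      unfolding S[symmetric] pw poch using Ga Ge by simp
    thus "kdf [\<alpha>] [?\<delta>1] [?\<gamma>1, 1 + \<alpha>/2, (\<alpha> - \<beta>)/2] [\<beta>] [] [\<alpha>/2, 1 + (\<alpha> + \<beta>)/2] (1/2) (1/2)
      = (2 powr (of_nat i - \<alpha> - 2) * Gamma (\<alpha> - of_nat i + 1) * Gamma (1 + (\<alpha> + \<beta>)/2))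
         / (Gamma (\<alpha> + 1) * Gamma ((\<beta> - \<alpha>)/2))
       * (\<Sum>r=0..i. (-1)^r * of_nat (i choose r)
            * Gamma ((\<beta> - \<alpha>)/4 + of_nat r / 2)
            / Gamma ((\<beta> + 3*\<alpha>)/4 + 1 - of_nat i + of_nat r / 2))"
      unfolding kdf_eq_regF[OF sums(1) den1 den2 den3 summable] d_def e_def S_def a_def .
  next
    assume summable: "kdf_term [\<alpha>] [?\<delta>2] [?\<gamma>2, 1 + \<alpha>/2, (\<alpha> - \<beta>)/2] [\<beta>] [] [\<alpha>/2, 1 + (\<alpha> + \<beta>)/2] (1/2) (1/2) summable_on UNIV"
    define S where "S = (\<Sum>r=0..i. of_nat (i choose r)
            * Gamma ((\<beta> - \<alpha>)/4 + of_nat r / 2)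
            / Gamma ((\<beta> + 3*\<alpha>)/4 + 1 + of_nat r / 2))"
    have S: "2 powr (1 + \<alpha> + of_nat i) * Gamma e * regF (1 + \<alpha>) (d - ?\<gamma>2) d = S"
    proof -
      have arg: "1 - (1 + \<alpha>) - of_nat i = d - ?\<gamma>2"
        by (simp add: d_def field_simps)
      have "(\<beta> + 3*\<alpha>)/4 + 1 + of_nat r / 2 = (e + of_nat r) / 2 + (1 + \<alpha>)" for r
        by (simp add: e_def field_simps)
      thus ?thesis
        using bailey_contiguous_minus[OF e, of "1 + \<alpha>" i, unfolded arg d_alt]
        by (simp only: S_def half[unfolded divide_inverse] atLeast0AtMost rGamma_inverse_Gamma divide_inverse)
    qed
    \<comment> \<open>The second factor 2 is the 1/2 from \<open>kdf_eq_regF\<close>.\<close>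
    have pw: "2 powr (- of_nat i - \<alpha> - 2) = 1 / (2 * 2 powr (1 + \<alpha> + of_nat i))"
    proof -
      have "2 powr (- of_nat i - \<alpha> - 2) * (2 powr (1 + \<alpha> + of_nat i) * 2 powr 1) = (1::complex)"
        unfolding powr_add[symmetric] by simp
      thus ?thesis by (simp add: field_simps)
    qed
    have "Gamma d / 2 * regF (1 + \<alpha>) (d - ?\<gamma>2) d = (2 powr (- of_nat i - \<alpha> - 2) * Gamma d) / Gamma e * S"
      unfolding S[symmetric] pw using Ge by simp
    thus "kdf [\<alpha>] [?\<delta>2] [?\<gamma>2, 1 + \<alpha>/2, (\<alpha> - \<beta>)/2] [\<beta>] [] [\<alpha>/2, 1 + (\<alpha> + \<beta>)/2] (1/2) (1/2)
      = (2 powr (- of_nat i - \<alpha> - 2) * Gamma (1 + (\<alpha> + \<beta>)/2)) / Gamma ((\<beta> - \<alpha>)/2)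
       * (\<Sum>r=0..i. of_nat (i choose r)
            * Gamma ((\<beta> - \<alpha>)/4 + of_nat r / 2)
            / Gamma ((\<beta> + 3*\<alpha>)/4 + 1 + of_nat r / 2))"
      unfolding kdf_eq_regF[OF sums(2) den1 den2 den3 summable] d_def e_def S_def .
  qed
qed

end
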